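(* Let $f$ be a completely additive function such that $f(k)>c\sqrt{\log(k)}$ for all integers $k\ge2$ and some constant $c>0$. Then $$f(2)\sum_{k\ge2}\frac{(-1)^k}{k f(k)}+(f(2))^2\sum_{k\ge2}\frac{1}{k f(k)f(2k)}=1.$$
   Context: A (real-valued) function $f$ defined on the positive integers is called completely additive if $f(mn)=f(m)+f(n)$ for all positive integers $m,n$. Here $\log$ is the natural logarithm, and the sums run over integers $k\ge2$.
   Formalization: The two series may both diverge under the hypothesis (e.g. f(p)=sqrt(log p) on primes), so the identity is proved as a limit of joint partial sums up to a common N; the two series converge or diverge together, and the displayed identity of separate sums is proved whenever they converge. *)

theory Defs imports Complex_Main begin

(* Functions on the positive integers are represented as functions on nat;
   the value at 0 is unconstrained. *)
definition completely_additive :: "(nat \<Rightarrow> real) \<Rightarrow> bool" where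
  "completely_additive f \<longleftrightarrow> (\<forall>m n. 0 < m \<longrightarrow> 0 < n \<longrightarrow> f (m * n) = f m + f n)"

definition alt_term :: "(nat \<Rightarrow> real) \<Rightarrow> nat \<Rightarrow> real" where
  "alt_term f k = (-1) ^ k / (real k * f k)"

definition prod_term :: "(nat \<Rightarrow> real) \<Rightarrow> nat \<Rightarrow> real" where
  "prod_term f k = 1 / (real k * f k * f (2 * k))"

(* Pitfall: under the hypothesis f k > c * sqrt (ln k) alone the two series, with terms
   alt_term f k and prod_term f k (k \<ge> 2), may diverge to minus and plus infinity.  For
   example, this happens for the completely additive f with f p = sqrt (ln p) on primes.
   A meaningful sum of the two is therefore the limit of the joint partial sums, and a
   separate suminf of each series has a meaning only when both are summable. *)

end

theory Submission imports Defs begin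

text \<open>
  Since \<open>f (2 * k) = f k + f 2\<close>, each term of the second series splits as a difference
  of two reciprocals, \<open>f 2 * prod_term f k = 1 / (k * f k) - 1 / (k * f (2 * k))\<close>.
  In the first series, writing an alternating sum as twice its even part minus the full sum
  produces the same two kinds of reciprocals with opposite signs. If the first series is cut off
  at \<open>2 * N\<close> and the second at \<open>N\<close>, all that remains, up to the common factor \<open>f 2\<close>,
  is the term \<open>1 / f 2\<close> coming from \<open>k = 2\<close> minus the sum of \<open>1 / (k * f k)\<close> over the
  block \<open>N < k \<le> 2 * N\<close> (lemma \<open>unequal_cutoff_identity\<close>).

  The lower bound on \<open>f\<close> makes this block at most \<open>1 / (c * sqrt (ln N))\<close>, which
  tends to zero (lemma \<open>dyadic_block_tendsto_0\<close>). The same block also bounds the change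
  of the first series when its cutoff moves from \<open>2 * N\<close> to \<open>N\<close>, so the joint partial
  sums with a common cutoff converge to 1. Thus the combination of the two series
  sums to 1 termwise, and as \<open>f 2 \<noteq> 0\<close> each series converges exactly when the other one
  does.
\<close>

definition dyadic_block :: "(nat \<Rightarrow> real) \<Rightarrow> nat \<Rightarrow> real" where
  "dyadic_block f N = (\<Sum>k=Suc N..2*N. 1 / (real k * f k))"

lemma completely_additive_double:
  assumes "completely_additive f" "0 < k"
  shows "f (2 * k) = f 2 + f k"
  using assms by (simp add: completely_additive_def)

lemma pos_if_sqrt_ln_bound:
  fixes c y :: real and k :: nat
  assumes "c > 0" "k \<ge> 2" "y > c * sqrt (ln (real k))"
  shows "y > 0"
proof -
  have "0 \<le> c * sqrt (ln (real k))" using assms(1,2) by simp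
  then show ?thesis using assms(3) by linarith
qed

lemma dyadic_block_Suc:
  assumes "N \<ge> 1"
  shows "dyadic_block f (Suc N) = dyadic_block f N - 1 / (real (Suc N) * f (Suc N))
     + 1 / (real (2*N+1) * f (2*N+1)) + 1 / (real (2*N+2) * f (2*N+2))"
proof -
  let ?g = "\<lambda>k. 1 / (real k * f k)"
  have "sum ?g {Suc N..2*N} = ?g (Suc N) + sum ?g {Suc (Suc N)..2*N}"
    using assms by (intro sum.atLeast_Suc_atMost) simp
  moreover have "sum ?g {Suc (Suc N)..2 * Suc N}
      = sum ?g {Suc (Suc N)..2*N} + ?g (2*N+1) + ?g (2*N+2)"
    using assms by simp
  ultimately show ?thesis
    unfolding dyadic_block_def by linarith
qed

text \<open>
  In passing from \<open>N\<close> to \<open>N + 1\<close>, the new product term (times \<open>f 2\<close>)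
  equals the reciprocal that leaves the block minus twice the new even alternating term. The
  doubling turns the sign of that even term from plus to minus, so that it agrees with the
  odd one; these two are the reciprocals that enter the block.
\<close>
lemma unequal_cutoff_identity:
  assumes add: "completely_additive f" and pos: "\<And>k. k \<ge> 2 \<Longrightarrow> f k > 0" and "N \<ge> 1"
  shows "f 2 * (\<Sum>k=2..2*N. alt_term f k) + (f 2)\<^sup>2 * (\<Sum>k=2..N. prod_term f k)
         = 1 - f 2 * dyadic_block f N"
  using \<open>N \<ge> 1\<close>
proof (induction N rule: dec_induct)
  case base
  have "f 2 > 0" using pos by simp
  then show ?case
    by (simp add: alt_term_def dyadic_block_def numeral_2_eq_2[symmetric])
next
  case (step N)
  have f2: "f 2 > 0" and fs: "f (Suc N) > 0" using pos step.hyps by auto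
  have double: "f (2 * Suc N) = f 2 + f (Suc N)"
    using completely_additive_double[OF add] by blast
  have telescope: "f 2 * prod_term f (Suc N)
      = 1 / (real (Suc N) * f (Suc N)) - 2 * (1 / (real (2*N+2) * f (2*N+2)))"
  proof -
    have "f 2 * prod_term f (Suc N) = f 2 / (real (Suc N) * f (Suc N) * (f 2 + f (Suc N)))"
      unfolding prod_term_def double by simp
    also have "\<dots> = 1 / (real (Suc N) * f (Suc N)) - 1 / (real (Suc N) * (f 2 + f (Suc N)))"
      using f2 fs by (simp add: divide_simps)
    also have "1 / (real (Suc N) * (f 2 + f (Suc N))) = 2 * (1 / (real (2*N+2) * f (2*N+2)))"
      using double f2 fs by (simp add: divide_simps)
    finally show ?thesis .
  qed
  have alt: "(\<Sum>k=2..2*Suc N. alt_term f k) = (\<Sum>k=2..2*N. alt_term f k)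
      - 1 / (real (2*N+1) * f (2*N+1)) + 1 / (real (2*N+2) * f (2*N+2))"
    using step.hyps by (simp add: alt_term_def)
  have prod: "(\<Sum>k=2..Suc N. prod_term f k) = (\<Sum>k=2..N. prod_term f k) + prod_term f (Suc N)"
    using step.hyps by simp
  have "f 2 * (\<Sum>k=2..2*Suc N. alt_term f k) + (f 2)\<^sup>2 * (\<Sum>k=2..Suc N. prod_term f k)
     = (f 2 * (\<Sum>k=2..2*N. alt_term f k) + (f 2)\<^sup>2 * (\<Sum>k=2..N. prod_term f k))
       + f 2 * (f 2 * prod_term f (Suc N) - 1 / (real (2*N+1) * f (2*N+1))
                + 1 / (real (2*N+2) * f (2*N+2)))"
    unfolding alt prod by (simp add: algebra_simps power2_eq_square del: of_nat_Suc of_nat_add)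
  also have "\<dots> = 1 - f 2 * dyadic_block f (Suc N)"
    unfolding step.IH telescope dyadic_block_Suc[OF step.hyps(1)] by (simp only: algebra_simps)
  finally show ?case .
qed

text \<open>
  The block has \<open>N\<close> terms, each at most \<open>1 / (N * c * sqrt (ln N))\<close>. This is the only
  place where the growth of \<open>f\<close>, beyond its positivity, enters.
\<close>
lemma dyadic_block_tendsto_0:
  assumes c: "c > 0" and lower: "\<And>k. k \<ge> 2 \<Longrightarrow> f k > c * sqrt (ln (real k))"
  shows "dyadic_block f \<longlonglongrightarrow> 0"
proof (rule tendsto_sandwich)
  have pos: "f k > 0" if "k \<ge> 2" for k
    using pos_if_sqrt_ln_bound[OF c that lower[OF that]] .
  show "\<forall>\<^sub>F N in sequentially. 0 \<le> dyadic_block f N"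
    using eventually_ge_at_top[of 1]
  proof eventually_elim
    case (elim N)
    show ?case
      unfolding dyadic_block_def using elim
      by (intro sum_nonneg divide_nonneg_nonneg mult_nonneg_nonneg less_imp_le[OF pos]) auto
  qed
  show "\<forall>\<^sub>F N in sequentially. dyadic_block f N \<le> 1 / (c * sqrt (ln (real N)))"
    using eventually_ge_at_top[of 2]
  proof eventually_elim
    case (elim N)
    have lnN: "ln (real N) > 0" using elim by simp
    have "1 / (real k * f k) \<le> 1 / (real N * (c * sqrt (ln (real N))))"
      if "k \<in> {Suc N..2*N}" for k
    proof -
      have "c * sqrt (ln (real N)) \<le> c * sqrt (ln (real k))"
        using that elim c by simp
      also have "\<dots> \<le> f k" using lower[of k] that elim by simp
      finally have "real N * (c * sqrt (ln (real N))) \<le> real k * f k"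
        using that elim c lnN by (intro mult_mono) auto
      moreover have "f k > 0" using that elim by (intro pos) simp
      ultimately show ?thesis
        using that elim c lnN by (intro divide_left_mono mult_pos_pos) auto
    qed
    then have "dyadic_block f N \<le> real (card {Suc N..2*N}) * (1 / (real N * (c * sqrt (ln (real N)))))"
      unfolding dyadic_block_def by (rule sum_bounded_above)
    also have "\<dots> = 1 / (c * sqrt (ln (real N)))" using elim by simp
    finally show ?case .
  qed
  have "filterlim (\<lambda>N. c * sqrt (ln (real N))) at_top sequentially"
    using c by (intro filterlim_tendsto_pos_mult_at_top[OF tendsto_const]
        filterlim_compose[OF sqrt_at_top] filterlim_compose[OF ln_at_top]
        filterlim_real_sequentially)
  then show "(\<lambda>N. 1 / (c * sqrt (ln (real N)))) \<longlonglongrightarrow> 0"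
    by (intro tendsto_divide_0[OF tendsto_const] filterlim_at_top_imp_at_infinity)
qed simp

lemma alternating_tail_le_dyadic_block:
  assumes pos: "\<And>k. k \<ge> 2 \<Longrightarrow> f k > 0" and "N \<ge> 1"
  shows "\<bar>(\<Sum>k=2..2*N. alt_term f k) - (\<Sum>k=2..N. alt_term f k)\<bar> \<le> dyadic_block f N"
proof -
  have "(\<Sum>k=2..2*N. alt_term f k) = (\<Sum>k=2..N. alt_term f k) + (\<Sum>k=Suc N..2*N. alt_term f k)"
    using \<open>N \<ge> 1\<close> sum.ub_add_nat[of 2 N "alt_term f" N] by (simp add: mult_2)
  moreover have "\<bar>\<Sum>k=Suc N..2*N. alt_term f k\<bar> \<le> dyadic_block f N"
    unfolding dyadic_block_def
  proof (rule order_trans[OF sum_abs], rule sum_mono)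
    fix k assume "k \<in> {Suc N..2*N}"
    then have "f k > 0" using \<open>N \<ge> 1\<close> by (intro pos) simp
    then show "\<bar>alt_term f k\<bar> \<le> 1 / (real k * f k)"
      by (simp add: alt_term_def abs_mult power_abs)
  qed
  ultimately show ?thesis by simp
qed

theorem mainTheorem1:
  fixes f :: "nat \<Rightarrow> real" and c :: real
  assumes "completely_additive f"
    and "c > 0"
    and "\<And>k::nat. k \<ge> 2 \<Longrightarrow> f k > c * sqrt (ln (real k))"
  shows "(\<lambda>N. f 2 * (\<Sum>k=2..N. alt_term f k) + (f 2)\<^sup>2 * (\<Sum>k=2..N. prod_term f k)) \<longlonglongrightarrow> 1
    \<and> (summable (\<lambda>n. alt_term f (n + 2)) \<longleftrightarrow> summable (\<lambda>n. prod_term f (n + 2)))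
    \<and> (summable (\<lambda>n. prod_term f (n + 2)) \<longrightarrow>
         f 2 * (\<Sum>n. alt_term f (n + 2)) + (f 2)\<^sup>2 * (\<Sum>n. prod_term f (n + 2)) = 1)"
proof -
  have pos: "f k > 0" if "k \<ge> 2" for k
    using pos_if_sqrt_ln_bound[OF assms(2) that assms(3)[OF that]] .
  have f2: "f 2 > 0" by (simp add: pos)
  define S where "S N = (\<Sum>k=2..N. alt_term f k)" for N
  define T where "T N = (\<Sum>k=2..N. prod_term f k)" for N
  note block0 = dyadic_block_tendsto_0[OF assms(2,3)]

  \<comment> \<open>moves the cutoff of the first series from \<open>2 * N\<close> down to that of the second\<close>
  have tail0: "(\<lambda>N. S (2*N) - S N) \<longlonglongrightarrow> 0"
  proof (rule tendsto_norm_zero_cancel, rule tendsto_sandwich[OF _ _ tendsto_const block0])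
    show "\<forall>\<^sub>F N in sequentially. norm (S (2*N) - S N) \<le> dyadic_block f N"
      using eventually_ge_at_top[of 1]
      by eventually_elim (simp add: S_def alternating_tail_le_dyadic_block pos)
  qed simp
  have "(\<lambda>N. 1 - f 2 * dyadic_block f N - f 2 * (S (2*N) - S N)) \<longlonglongrightarrow> 1 - f 2 * 0 - f 2 * 0"
    by (intro tendsto_intros block0 tail0)
  moreover have "\<forall>\<^sub>F N in sequentially. 1 - f 2 * dyadic_block f N - f 2 * (S (2*N) - S N)
      = f 2 * S N + (f 2)\<^sup>2 * T N"
    using eventually_ge_at_top[of 1]
  proof eventually_elim
    case (elim N)
    show ?case
      using unequal_cutoff_identity[OF assms(1) pos elim]
      by (simp add: S_def T_def algebra_simps)
  qed
  ultimately have joint: "(\<lambda>N. f 2 * S N + (f 2)\<^sup>2 * T N) \<longlonglongrightarrow> 1"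
    by (simp add: tendsto_cong)

  let ?a = "\<lambda>n. alt_term f (n + 2)" and ?b = "\<lambda>n. prod_term f (n + 2)"
  have shift: "(\<Sum>n<M. g (n + 2)) = (\<Sum>k=2..Suc M. g k)" for g :: "nat \<Rightarrow> real" and M
    by (induction M) simp_all
  have sums1: "(\<lambda>n. f 2 * ?a n + (f 2)\<^sup>2 * ?b n) sums 1"
    using LIMSEQ_Suc[OF joint]
    by (simp only: sums_def sum.distrib sum_distrib_left[symmetric] shift S_def T_def)
  have "summable ?a" if "summable ?b"
  proof -
    have "summable (\<lambda>n. (f 2 * ?a n + (f 2)\<^sup>2 * ?b n) - (f 2)\<^sup>2 * ?b n)"
      by (intro summable_diff sums_summable[OF sums1] summable_mult that)
    then show ?thesis using f2 by (simp add: summable_cmult_iff)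
  qed
  moreover have "summable ?b" if "summable ?a"
  proof -
    have "summable (\<lambda>n. (f 2 * ?a n + (f 2)\<^sup>2 * ?b n) - f 2 * ?a n)"
      by (intro summable_diff sums_summable[OF sums1] summable_mult that)
    then show ?thesis using f2 by (simp add: summable_cmult_iff)
  qed
  ultimately have iff: "summable ?a \<longleftrightarrow> summable ?b" by blast
  have "f 2 * suminf ?a + (f 2)\<^sup>2 * suminf ?b = 1" if "summable ?b"
  proof -
    have "(\<lambda>n. f 2 * ?a n + (f 2)\<^sup>2 * ?b n) sums (f 2 * suminf ?a + (f 2)\<^sup>2 * suminf ?b)"
      using that iff by (intro sums_add sums_mult summable_sums) auto
    then show ?thesis using sums1 sums_unique2 by blast
  qed
  with joint iff show ?thesis unfolding S_def T_def by blast
qed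

end
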